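(* In the setting fixed in the context, let $\beta(t)=t^{r_1}$ and $\epsilon(t)=\frac{c}{t^{r_2}}$ for $t\ge t_0$, with $1<r_2\le r_1+1$ and $c>0$. Suppose that $\frac1\delta\le\gamma$ and $r_1\le\frac{t}{\delta}$ for all $t\ge t_0$. Let $(x,y,\lambda):[t_0,+\infty)\to\mathcal{X}\times\mathcal{Y}\times\mathcal{Z}$ be a solution of the dynamical system (DS), and let $(x^*,y^*,\lambda^* )\in\Omega$. Then: (i) If $1<r_2<r_1+1$, then $\mathcal{L}(x(t),y(t),\lambda^* )-\mathcal{L}(x^*,y^*,\lambda^* )=\mathcal{O}\left(\frac{1}{t^{r_2-1}}\right)$ as $t\to+\infty$. (ii) If $r_2=r_1+1$, then $\mathcal{L}(x(t),y(t),\lambda^* )-\mathcal{L}(x^*,y^*,\lambda^* )=\mathcal{O}\left(\frac{\ln t}{t^{r_1}}\right)$ as $t\to+\infty$.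
   Context: Let $\mathcal{X},\mathcal{Y},\mathcal{Z}$ be real Hilbert spaces, $A:\mathcal{X}\to\mathcal{Z}$ and $B:\mathcal{Y}\to\mathcal{Z}$ continuous linear operators with adjoints $A^\top,B^\top$, and $b\in\mathcal{Z}$. Let $f:\mathcal{X}\to\mathbb{R}$ and $g:\mathcal{Y}\to\mathbb{R}$ be continuously differentiable convex functions, with $\nabla f$ $l_1$-Lipschitz continuous ($l_1>0$) and $\nabla g$ $l_2$-Lipschitz continuous ($l_2>0$). The problem under study is to minimize $f(x)+g(y)$ over $(x,y)\in\mathcal{X}\times\mathcal{Y}$ subject to $Ax+By=b$. The augmented Lagrangian is $$\mathcal{L}(x,y,\lambda)=f(x)+g(y)+\langle\lambda,Ax+By-b\rangle+\tfrac12\|Ax+By-b\|^2 .$$ $\Omega$ denotes its set of saddle points: $(x^*,y^*,\lambda^* )\in\Omega$ iff $\mathcal{L}(x^*,y^*,\lambda)\le\mathcal{L}(x^*,y^*,\lambda^* )\le\mathcal{L}(x,y,\lambda^* )$ for all $(x,y,\lambda)\in\mathcal{X}\times\mathcal{Y}\times\mathcal{Z}$; equivalently $-A^\top\lambda^*=\nabla f(x^* )$, $-B^\top\lambda^*=\nabla g(y^* )$, $Ax^*+By^*=b$. It is assumed that $\Omega\neq\emptyset$. Let $t_0>0$, $\gamma>0$, $\delta>0$ be constants. For given $\beta:[t_0,+\infty)\to(0,+\infty)$ and $\epsilon:[t_0,+\infty)\to[0,+\infty)$, the dynamical system (DS) is, for $t\ge t_0$, $$\begin{cases}\ddot{x}(t)+\gamma\dot{x}(t)+\beta(t)\big(\nabla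 f(x(t))+A^\top\lambda(t)+A^\top(Ax(t)+By(t)-b)+\epsilon(t)x(t)\big)=0,\\ \ddot{y}(t)+\gamma\dot{y}(t)+\beta(t)\big(\nabla g(y(t))+B^\top\lambda(t)+B^\top(Ax(t)+By(t)-b)+\epsilon(t)y(t)\big)=0,\\ \dot{\lambda}(t)-\beta(t)\big(A(x(t)+\delta\dot{x}(t))+B(y(t)+\delta\dot{y}(t))-b\big)=0,\end{cases}$$ and a solution is a triple $(x,y,\lambda)$ with $x,y$ twice differentiable and $\lambda$ differentiable satisfying these equations for all $t\ge t_0$. *)

theory Defs
  imports "HOL-Analysis.Analysis" "HOL-Library.Landau_Symbols"
begin

definition aug_lagrangian ::
  "('x::real_inner \<Rightarrow> real) \<Rightarrow> ('y::real_inner \<Rightarrow> real) \<Rightarrow> ('x \<Rightarrow> 'z::real_inner) \<Rightarrow> ('y \<Rightarrow> 'z) \<Rightarrow> 'z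
    \<Rightarrow> 'x \<Rightarrow> 'y \<Rightarrow> 'z \<Rightarrow> real"
  where "aug_lagrangian f g A B b x y lam =
    f x + g y + inner lam (A x + B y - b) + 1/2 * (norm (A x + B y - b))\<^sup>2"

definition saddle_points ::
  "('x::real_inner \<Rightarrow> real) \<Rightarrow> ('y::real_inner \<Rightarrow> real) \<Rightarrow> ('x \<Rightarrow> 'z::real_inner) \<Rightarrow> ('y \<Rightarrow> 'z) \<Rightarrow> 'z
    \<Rightarrow> ('x \<times> 'y \<times> 'z) set"
  where "saddle_points f g A B b =
    {(xs, ys, lams). \<forall>x y lam.
       aug_lagrangian f g A B b xs ys lam \<le> aug_lagrangian f g A B b xs ys lams \<and>
       aug_lagrangian f g A B b xs ys lams \<le> aug_lagrangian f g A B b x y lams}"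

text \<open>
  Trajectories are functions on all of \<^typ>\<open>real\<close>, of which only the restriction to
  \<open>{t0..}\<close> matters: derivatives are taken within that set, hence one-sided at \<open>t0\<close>.
  The arguments \<open>gradf\<close>, \<open>gradg\<close> are the gradients of the two objective functions, and
  \<open>x1\<close>, \<open>x2\<close> are the first and second derivatives of \<open>x\<close>. For continuous linear operators
  between Hilbert spaces the library constant \<^const>\<open>adjoint\<close>, although defined by a choice
  operator, is the usual adjoint (which exists by the Riesz representation theorem and is unique).
\<close>

definition ds_solution ::
  "real \<Rightarrow> real \<Rightarrow> real \<Rightarrow> (real \<Rightarrow> real) \<Rightarrow> (real \<Rightarrow> real)
    \<Rightarrow> ('x::real_inner \<Rightarrow> 'x) \<Rightarrow> ('y::real_inner \<Rightarrow> 'y)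
    \<Rightarrow> ('x \<Rightarrow> 'z::real_inner) \<Rightarrow> ('y \<Rightarrow> 'z) \<Rightarrow> 'z
    \<Rightarrow> (real \<Rightarrow> 'x) \<Rightarrow> (real \<Rightarrow> 'y) \<Rightarrow> (real \<Rightarrow> 'z) \<Rightarrow> bool"
  where "ds_solution t0 \<gamma> \<delta> \<beta> \<epsilon> gradf gradg A B b x y lam \<longleftrightarrow>
    (\<exists>x1 x2 y1 y2 lam1. \<forall>t\<ge>t0.
       (x has_vector_derivative x1 t) (at t within {t0..}) \<and>
       (x1 has_vector_derivative x2 t) (at t within {t0..}) \<and>
       (y has_vector_derivative y1 t) (at t within {t0..}) \<and>
       (y1 has_vector_derivative y2 t) (at t within {t0..}) \<and>
       (lam has_vector_derivative lam1 t) (at t within {t0..}) \<and>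
       x2 t + \<gamma> *\<^sub>R x1 t + \<beta> t *\<^sub>R (gradf (x t) + adjoint A (lam t)
          + adjoint A (A (x t) + B (y t) - b) + \<epsilon> t *\<^sub>R x t) = 0 \<and>
       y2 t + \<gamma> *\<^sub>R y1 t + \<beta> t *\<^sub>R (gradg (y t) + adjoint B (lam t)
          + adjoint B (A (x t) + B (y t) - b) + \<epsilon> t *\<^sub>R y t) = 0 \<and>
       lam1 t - \<beta> t *\<^sub>R (A (x t + \<delta> *\<^sub>R x1 t) + B (y t + \<delta> *\<^sub>R y1 t) - b) = 0)"

end

theory Submission
  imports Defs
begin

text \<open>
  Write \<open>w = (x, y)\<close>, \<open>ws = (xs, ys)\<close> and let \<open>gap\<close> be the Lagrangian gap at \<open>lams\<close>. Along a solution, the energy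
  \<open>\<delta>\<^sup>2 \<beta> (gap + \<epsilon>/2 |w|\<^sup>2) + 1/2 |w - ws + \<delta> w'|\<^sup>2 + (\<delta>\<gamma> - 1)/2 |w - ws|\<^sup>2 + \<delta>/2 |lam - lams|\<^sup>2\<close>
  has derivative at most \<open>\<delta>/2 |ws|\<^sup>2 \<beta> \<epsilon>\<close>: the multiplier terms cancel, and the remaining terms are
  nonpositive by convexity and because \<open>\<delta> \<beta>' \<le> \<beta>\<close>, \<open>\<epsilon>' \<le> 0\<close> and \<open>\<delta>\<gamma> \<ge> 1\<close>. Integrating
  \<open>\<beta> \<epsilon> = c t powr (r1 - r2)\<close> and dividing by \<open>\<beta> = t powr r1\<close> gives both rates.
\<close>

section \<open>Riesz representation and the adjoint identity\<close>

lemma riesz_representation: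
  fixes \<phi> :: "'x::{real_inner,complete_space} \<Rightarrow> real"
  assumes "bounded_linear \<phi>"
  obtains v where "\<And>u. \<phi> u = inner u v"
proof -
  interpret bounded_linear \<phi> by fact
  \<comment> \<open>The representing vector is the minimizer of \<open>J\<close>; the midpoint identity makes minimizing
    sequences Cauchy.\<close>
  define J where "J u = inner u u / 2 - \<phi> u" for u
  obtain k where k: "\<And>u. norm (\<phi> u) \<le> norm u * k"
    using bounded by blast
  have "- k\<^sup>2 / 2 \<le> J u" for u
  proof -
    have "0 \<le> (norm u - k)\<^sup>2 / 2" by simp
    then show ?thesis
      using k[of u] unfolding J_def power2_norm_eq_inner[symmetric]
      by (simp add: power2_eq_square algebra_simps)
  qed
  then have bdd: "bdd_below (range J)" by (intro bdd_belowI[of _ "- k\<^sup>2 / 2"]) auto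
  define m where "m = Inf (range J)"
  have m_le: "m \<le> J u" for u
    unfolding m_def using bdd by (auto intro: cInf_lower)
  have "\<exists>u. J u < m + 1 / (real n + 1)" for n
    using cInf_lessD[of "range J" "m + 1 / (real n + 1)"] by (auto simp: m_def add_pos_nonneg)
  then obtain X where X: "\<And>n. J (X n) < m + 1 / (real n + 1)"
    by metis
  have midpoint: "inner (u - v) (u - v) / 4 = J u + J v - 2 * J ((1/2) *\<^sub>R (u + v))" for u v
    unfolding J_def by (simp add: add scaleR inner_simps inner_commute field_simps)
  have "Cauchy X"
  proof (rule metric_CauchyI)
    fix e :: real assume "e > 0"
    \<comment> \<open>By \<open>midpoint\<close> and \<open>m_le\<close>, a quarter of the squared
      distance is at most the sum of the two excesses over \<open>m\<close>, hence at most
      \<open>2 / real M\<close>; the constant 8 brings this below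
      \<open>e\<^sup>2 / 4\<close>.\<close>
    then obtain M :: nat where M: "8 / e\<^sup>2 < real M"
      using reals_Archimedean2 by blast
    have "dist (X i) (X j) < e" if "i \<ge> M" "j \<ge> M" for i j
    proof -
      have "real M > 0" using M \<open>e > 0\<close> by (smt (verit) divide_nonneg_nonneg zero_le_power2)
      have le: "1 / (real n + 1) \<le> 1 / real M" if "n \<ge> M" for n
        using that \<open>real M > 0\<close> by (intro divide_left_mono) auto
      have "inner (X i - X j) (X i - X j) / 4 \<le> 2 / real M"
        unfolding midpoint using X[of i] X[of j] m_le[of "(1/2) *\<^sub>R (X i + X j)"]
          le[OF that(1)] le[OF that(2)] by simp
      also have "\<dots> < e\<^sup>2 / 4"
        using M \<open>e > 0\<close> \<open>real M > 0\<close> by (simp add: field_simps)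
      finally have "(dist (X i) (X j))\<^sup>2 < e\<^sup>2"
        by (simp add: dist_norm power2_norm_eq_inner)
      then show ?thesis using \<open>e > 0\<close> by (simp add: power_less_imp_less_base)
    qed
    then show "\<exists>M. \<forall>i\<ge>M. \<forall>j\<ge>M. dist (X i) (X j) < e" by blast
  qed
  then obtain v where v: "X \<longlonglongrightarrow> v"
    using Cauchy_convergent_iff convergent_def by blast
  have "(\<lambda>n. J (X n)) \<longlonglongrightarrow> J v"
    unfolding J_def by (intro tendsto_intros tendsto v) simp
  moreover have "(\<lambda>n. m + 1 / (real n + 1)) \<longlonglongrightarrow> m + 0"
    using LIMSEQ_Suc[OF lim_1_over_n] by (intro tendsto_add tendsto_const) (simp add: add.commute)
  ultimately have "J v \<le> m"
    using X by (intro LIMSEQ_le[of "\<lambda>n. J (X n)" _ "\<lambda>n. m + 1 / (real n + 1)"]) (auto intro: less_imp_le)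
  have "\<phi> u = inner u v" for u
  proof (cases "u = 0")
    case False
    \<comment> \<open>\<open>d\<close> is the directional derivative of \<open>J\<close> at
      \<open>v\<close> along \<open>u\<close>, and \<open>s\<close> minimizes the quadratic
      \<open>J (v + s *\<^sub>R u)\<close>. That minimum lies
      \<open>d\<^sup>2 / (2 * inner u u)\<close> below \<open>J v\<close>, so minimality of
      \<open>v\<close> forces \<open>d = 0\<close>.\<close>
    define d where "d = inner u v - \<phi> u"
    define s where "s = - d / inner u u"
    have "J (v + s *\<^sub>R u) = J v + s * d + s\<^sup>2 * inner u u / 2"
      unfolding J_def d_def
      by (simp add: add scaleR inner_simps algebra_simps power2_eq_square inner_commute)
    also have "\<dots> = J v - d\<^sup>2 / (2 * inner u u)"
      using False by (simp add: s_def power2_eq_square field_simps)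
    finally have "d\<^sup>2 / (2 * inner u u) \<le> 0"
      using m_le[of "v + s *\<^sub>R u"] \<open>J v \<le> m\<close> by simp
    moreover have "inner u u > 0" using False by simp
    ultimately show ?thesis
      by (simp add: d_def divide_le_0_iff)
  qed (simp add: zero)
  then show thesis by (rule that)
qed

text \<open>\<open>adjoint\<close> is defined by choice, so the identity rests on existence: for
  each \<open>z\<close> the functional sending \<open>u\<close> to \<open>inner (A u) z\<close> is
  bounded and has a Riesz representative.\<close>

lemma inner_adjoint:
  fixes A :: "'x::{real_inner,complete_space} \<Rightarrow> 'z::real_inner"
  assumes "bounded_linear A"
  shows "inner (A u) z = inner u (adjoint A z)"
proof -
  have "\<exists>v. \<forall>u. inner (A u) z = inner u v" for z
    by (rule riesz_representation[OF bounded_linear_compose[OF bounded_linear_inner_left assms]]) blast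
  then obtain A' where "\<forall>u z. inner (A u) z = inner u (A' z)"
    by metis
  then show ?thesis
    unfolding adjoint_def by (rule someI2[where Q = "\<lambda>A'. inner (A u) z = inner u (A' z)"]) blast
qed

section \<open>Convexity and derivatives along trajectories\<close>

text \<open>Restriction to the line through \<open>u\<close> and \<open>v\<close> leaves one real
  variable: the claim is the tangent inequality for \<open>\<phi>\<close> at 0, evaluated at
  1.\<close>

lemma convex_on_GDERIV_le:
  fixes f :: "'x::real_inner \<Rightarrow> real"
  assumes "convex_on UNIV f" and "GDERIV f u :> D"
  shows "f u + inner (v - u) D \<le> f v"
proof -
  define \<phi> where "\<phi> s = f (u + s *\<^sub>R (v - u))" for s :: real
  have "convex_on UNIV \<phi>"
  proof (rule convex_onI)
    fix t s s' :: real assume "0 < t" "t < 1"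
    then show "\<phi> ((1 - t) *\<^sub>R s + t *\<^sub>R s') \<le> (1 - t) * \<phi> s + t * \<phi> s'"
      using convex_onD[OF assms(1), of t "u + s *\<^sub>R (v - u)" "u + s' *\<^sub>R (v - u)"]
      by (simp add: \<phi>_def algebra_simps)
  qed simp
  moreover have "(\<phi> has_real_derivative inner (v - u) D) (at 0)"
  proof -
    have "((\<lambda>s. u + s *\<^sub>R (v - u)) has_derivative (\<lambda>s. s *\<^sub>R (v - u))) (at 0)"
      by (auto intro!: derivative_eq_intros)
    from has_derivative_compose[OF this, of f "\<lambda>k. inner k D"] assms(2)
    show ?thesis
      by (simp add: \<phi>_def[abs_def] gderiv_def has_field_derivative_def mult_commute_abs)
  qed
  ultimately have "\<phi> 1 - \<phi> 0 \<ge> inner (v - u) D * (1 - 0)"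
    by (intro convex_on_imp_above_tangent[of UNIV \<phi> 0]) auto
  then show ?thesis by (simp add: \<phi>_def)
qed

lemma has_real_derivative_inner_self:
  assumes "(u has_vector_derivative u') (at t within S)"
  shows "((\<lambda>t. inner (u t) (u t)) has_real_derivative 2 * inner (u t) u') (at t within S)"
  using bounded_bilinear.has_vector_derivative[OF bounded_bilinear_inner assms assms]
  by (simp add: has_real_derivative_iff_has_vector_derivative inner_commute)

lemma has_real_derivative_GDERIV_compose:
  assumes "(w has_vector_derivative w') (at t within S)" and "GDERIV h (w t) :> D"
  shows "((\<lambda>t. h (w t)) has_real_derivative inner w' D) (at t within S)"
  using has_derivative_compose[of w "\<lambda>s. s *\<^sub>R w'" t S h "\<lambda>k. inner k D"] assms
  by (simp add: gderiv_def has_vector_derivative_def has_field_derivative_def mult_commute_abs)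

text \<open>A one-sided derivative at \<open>a\<close> is enough, since the mean value theorem is
  applied with derivatives taken within \<open>{a..t}\<close>.\<close>

lemma nonincreasing_if_derivative_nonpos:
  fixes E :: "real \<Rightarrow> real"
  assumes "\<And>s. s \<ge> a \<Longrightarrow> (E has_real_derivative E' s) (at s within {a..})"
    and "\<And>s. s \<ge> a \<Longrightarrow> E' s \<le> 0" and "a \<le> t"
  shows "E t \<le> E a"
proof -
  have "(E has_derivative (\<lambda>h. h * E' s)) (at s within {a..t})" if "a \<le> s" for s
    using has_field_derivative_subset[OF assms(1)[OF that], of "{a..t}"]
    by (auto simp: has_field_derivative_def mult_commute_abs)
  then obtain s where "s \<in> {a..t}" "E t - E a = (t - a) * E' s"
    using mvt_very_simple[of a t E "\<lambda>s h. h * E' s"] \<open>a \<le> t\<close> by auto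
  then show ?thesis
    using assms(2)[of s] \<open>a \<le> t\<close> mult_nonneg_nonpos[of "t - a" "E' s"] by auto
qed

section \<open>The energy estimate on the product space\<close>

text \<open>
  The constraint map \<open>K\<close> stands for \<open>K (x, y) = A x + B y\<close> on the product space.
\<close>

lemma lyapunov_gap_bound:
  fixes h :: "'w::real_inner \<Rightarrow> real" and K :: "'w \<Rightarrow> 'z::real_inner"
    and ws :: 'w and b lams :: 'z and \<beta> \<epsilon> \<Phi> :: "real \<Rightarrow> real"
    and w w1 w2 :: "real \<Rightarrow> 'w" and lam :: "real \<Rightarrow> 'z"
  defines "gap \<equiv> \<lambda>u. h u + inner lams (K u - b) + 1/2 * (norm (K u - b))\<^sup>2 - h ws"
  assumes K: "bounded_linear K" and K': "\<And>u z. inner (K u) z = inner u (K' z)"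
    and grad: "\<And>u. GDERIV h u :> gradh u"
    and conv: "\<And>u. h u + inner (ws - u) (gradh u) \<le> h ws"
    and feasible: "K ws = b" and gap_nonneg: "\<And>u. 0 \<le> gap u"
    and "\<delta> > 0" and "1 / \<delta> \<le> \<gamma>"
    and dw: "\<And>t. t \<ge> t0 \<Longrightarrow> (w has_vector_derivative w1 t) (at t within {t0..})"
    and dw1: "\<And>t. t \<ge> t0 \<Longrightarrow> (w1 has_vector_derivative w2 t) (at t within {t0..})"
    and dlam: "\<And>t. t \<ge> t0 \<Longrightarrow> (lam has_vector_derivative
        \<beta> t *\<^sub>R (K (w t + \<delta> *\<^sub>R w1 t) - b)) (at t within {t0..})"
    and ode: "\<And>t. t \<ge> t0 \<Longrightarrow> w2 t + \<gamma> *\<^sub>R w1 t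
        + \<beta> t *\<^sub>R (gradh (w t) + K' (lam t) + K' (K (w t) - b) + \<epsilon> t *\<^sub>R w t) = 0"
    and d\<beta>: "\<And>t. t \<ge> t0 \<Longrightarrow> (\<beta> has_real_derivative \<beta>1 t) (at t within {t0..})"
    and d\<epsilon>: "\<And>t. t \<ge> t0 \<Longrightarrow> (\<epsilon> has_real_derivative \<epsilon>1 t) (at t within {t0..})"
    and d\<Phi>: "\<And>t. t \<ge> t0 \<Longrightarrow> (\<Phi> has_real_derivative \<beta> t * \<epsilon> t) (at t within {t0..})"
    and \<beta>_nonneg: "\<And>t. t \<ge> t0 \<Longrightarrow> 0 \<le> \<beta> t" and \<beta>1: "\<And>t. t \<ge> t0 \<Longrightarrow> \<delta> * \<beta>1 t \<le> \<beta> t"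
    and \<epsilon>_nonneg: "\<And>t. t \<ge> t0 \<Longrightarrow> 0 \<le> \<epsilon> t" and \<epsilon>1: "\<And>t. t \<ge> t0 \<Longrightarrow> \<epsilon>1 t \<le> 0"
  obtains C where "\<And>t. t \<ge> t0 \<Longrightarrow> \<delta>\<^sup>2 * \<beta> t * gap (w t) \<le> C + \<delta> / 2 * (norm ws)\<^sup>2 * \<Phi> t"
proof -
  interpret K: bounded_linear K by fact
  have \<gamma>\<delta>: "1 \<le> \<delta> * \<gamma>" using \<open>1 / \<delta> \<le> \<gamma>\<close> \<open>\<delta> > 0\<close> by (simp add: field_simps)
  define V where "V t = w t - ws + \<delta> *\<^sub>R w1 t" for t
  \<comment> \<open>The weights are forced by cancellation. With
    \<open>\<delta>\<^sup>2 * \<beta> t\<close>, the gradient terms paired with \<open>w1\<close>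
    cancel those from the \<open>\<delta> *\<^sub>R w1 t\<close> part of \<open>V\<close>;
    \<open>(\<delta> * \<gamma> - 1) / 2\<close> removes the cross term of \<open>w t - ws\<close>
    and \<open>w1 t\<close> left by the damping; \<open>\<delta> / 2\<close> removes
    \<open>lam t\<close>.\<close>
  define E where "E t = \<delta>\<^sup>2 * \<beta> t * (gap (w t) + \<epsilon> t / 2 * inner (w t) (w t))
      + 1/2 * inner (V t) (V t) + (\<delta> * \<gamma> - 1) / 2 * inner (w t - ws) (w t - ws)
      + \<delta> / 2 * inner (lam t - lams) (lam t - lams)" for t
  \<comment> \<open>The derivative of \<open>E\<close>, grouped so that every term but the last is
    nonpositive. Writing \<open>inner (w - ws) w\<close> as half of |w|^2 + |w - ws|^2 - |ws|^2
    splits the regularization term and produces the last summand; splitting off \<open>gap\<close>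
    turns the remaining gradient term into the convexity defect plus half the squared
    residual.\<close>
  define D where "D t = \<delta> * (1 - \<delta> * \<gamma>) * inner (w1 t) (w1 t)
      + \<delta> * (\<delta> * \<beta>1 t - \<beta> t) * (gap (w t) + \<epsilon> t / 2 * inner (w t) (w t))
      + \<delta>\<^sup>2 * \<beta> t * \<epsilon>1 t / 2 * inner (w t) (w t)
      - \<delta> * \<beta> t * \<epsilon> t / 2 * inner (w t - ws) (w t - ws)
      - \<delta> * \<beta> t * (h ws - h (w t) - inner (ws - w t) (gradh (w t))
          + 1/2 * inner (K (w t) - b) (K (w t) - b))
      + \<delta> / 2 * inner ws ws * (\<beta> t * \<epsilon> t)" for t
  have dE: "(E has_real_derivative D t) (at t within {t0..})" if t: "t \<ge> t0" for t
  proof -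
    define R where "R = K (w t) - b"
    define R1 where "R1 = K (w1 t)"
    have Kd: "((\<lambda>t. K (w t) - b) has_vector_derivative R1) (at t within {t0..})"
      unfolding has_vector_derivative_diff_const R1_def
      by (rule K.has_vector_derivative[OF dw[OF t]])
    have "((\<lambda>t. inner lams (K (w t) - b)) has_real_derivative inner lams R1) (at t within {t0..})"
      using bounded_linear.has_vector_derivative[OF bounded_linear_inner_right Kd]
      by (simp add: has_real_derivative_iff_has_vector_derivative)
    note dgap = DERIV_diff[OF DERIV_add[OF DERIV_add[OF
          has_real_derivative_GDERIV_compose[OF dw[OF t] grad] this]
          DERIV_cmult[OF has_real_derivative_inner_self[OF Kd], of "1/2"]] DERIV_const[of "h ws"]]
    have dgap': "((\<lambda>t. gap (w t)) has_real_derivative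
        inner (w1 t) (gradh (w t)) + inner lams R1 + inner R R1) (at t within {t0..})"
      using dgap unfolding gap_def power2_norm_eq_inner by (simp add: R_def)
    have du: "((\<lambda>t. w t - ws) has_vector_derivative w1 t) (at t within {t0..})"
      unfolding has_vector_derivative_diff_const by (rule dw[OF t])
    have dV: "(V has_vector_derivative w1 t + \<delta> *\<^sub>R w2 t) (at t within {t0..})"
      unfolding V_def using has_vector_derivative_add[OF du
          bounded_linear.has_vector_derivative[OF bounded_linear_scaleR_right dw1[OF t]]] .
    have dl: "((\<lambda>t. lam t - lams) has_vector_derivative \<beta> t *\<^sub>R (R + \<delta> *\<^sub>R R1)) (at t within {t0..})"
      unfolding has_vector_derivative_diff_const using dlam[OF t]
      by (simp add: R_def R1_def K.add K.scaleR algebra_simps)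
    define D' where "D' = \<delta>\<^sup>2 * \<beta>1 t * (gap (w t) + \<epsilon> t / 2 * inner (w t) (w t))
      + \<delta>\<^sup>2 * \<beta> t * (inner (w1 t) (gradh (w t)) + inner lams R1 + inner R R1
          + \<epsilon>1 t / 2 * inner (w t) (w t) + \<epsilon> t * inner (w t) (w1 t))
      + inner (V t) (w1 t + \<delta> *\<^sub>R w2 t) + (\<delta> * \<gamma> - 1) * inner (w t - ws) (w1 t)
      + \<delta> * inner (lam t - lams) (\<beta> t *\<^sub>R (R + \<delta> *\<^sub>R R1))"
    have "(E has_real_derivative D') (at t within {t0..})"
      unfolding E_def
      by (rule DERIV_cong[OF DERIV_add[OF DERIV_add[OF DERIV_add[OF
              DERIV_mult[OF DERIV_cmult[OF d\<beta>[OF t]] DERIV_add[OF dgap'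
                DERIV_mult[OF DERIV_cdivide[OF d\<epsilon>[OF t]] has_real_derivative_inner_self[OF dw[OF t]]]]]
              DERIV_cmult[OF has_real_derivative_inner_self[OF dV]]]
              DERIV_cmult[OF has_real_derivative_inner_self[OF du]]]
              DERIV_cmult[OF has_real_derivative_inner_self[OF dl]]]])
        (simp add: D'_def algebra_simps diff_divide_distrib)
    \<comment> \<open>\<open>D'\<close> is the plain product rule; only here is the second-order
      equation substituted for \<open>w2 t\<close>.\<close>
    moreover have "D' = D t"
    proof -
      have w2: "w2 t = - (\<gamma> *\<^sub>R w1 t
          + \<beta> t *\<^sub>R (gradh (w t) + K' (lam t) + K' R + \<epsilon> t *\<^sub>R w t))"
        using ode[OF t] by (simp only: eq_neg_iff_add_eq_0 R_def add.assoc)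
      \<comment> \<open>The image of \<open>V\<close> under \<open>K\<close> is, by feasibility of
        \<open>ws\<close>, the very vector that drives the multiplier. Moving \<open>K'\<close>
        across the inner product therefore gives the \<open>lam t\<close> term that cancels against
        the derivative of the multiplier energy.\<close>
      have KV: "K (V t) = R + \<delta> *\<^sub>R R1"
        by (simp add: V_def R_def R1_def K.add K.diff K.scaleR feasible)
      have Vw2: "inner (V t) (w2 t) = - \<gamma> * inner (V t) (w1 t) - \<beta> t * (inner (V t) (gradh (w t))
          + inner (R + \<delta> *\<^sub>R R1) (lam t) + inner (R + \<delta> *\<^sub>R R1) R + \<epsilon> t * inner (V t) (w t))"
        unfolding w2 KV[symmetric] K' by (simp add: inner_simps algebra_simps)
      have Vw: "inner (V t) (w1 t + \<delta> *\<^sub>R w2 t) = (1 - \<delta> * \<gamma>) * inner (V t) (w1 t)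
          - \<delta> * \<beta> t * (inner (V t) (gradh (w t)) + inner (R + \<delta> *\<^sub>R R1) (lam t)
          + inner (R + \<delta> *\<^sub>R R1) R + \<epsilon> t * inner (V t) (w t))"
        unfolding inner_add_right inner_scaleR_right Vw2 by (simp add: algebra_simps)
      show ?thesis
        unfolding D'_def D_def gap_def R_def[symmetric] power2_norm_eq_inner Vw
        by (simp add: inner_simps V_def inner_commute) (simp add: algebra_simps add_divide_distrib diff_divide_distrib power2_eq_square)
    qed
    ultimately show ?thesis by simp
  qed
  have D_le: "D t - \<delta> / 2 * inner ws ws * (\<beta> t * \<epsilon> t) \<le> 0" if t: "t \<ge> t0" for t
  proof -
    note pos = \<beta>_nonneg[OF t] \<epsilon>_nonneg[OF t] \<open>\<delta> > 0\<close>
    have "\<delta> * (1 - \<delta> * \<gamma>) * inner (w1 t) (w1 t) \<le> 0"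
      using \<gamma>\<delta> \<open>\<delta> > 0\<close> by (intro mult_nonpos_nonneg mult_nonneg_nonpos) auto
    moreover have "\<delta> * (\<delta> * \<beta>1 t - \<beta> t) * (gap (w t) + \<epsilon> t / 2 * inner (w t) (w t)) \<le> 0"
      using \<beta>1[OF t] gap_nonneg[of "w t"] pos
      by (intro mult_nonpos_nonneg mult_nonneg_nonpos add_nonneg_nonneg mult_nonneg_nonneg) auto
    moreover have "\<delta>\<^sup>2 * \<beta> t * \<epsilon>1 t / 2 * inner (w t) (w t) \<le> 0"
      using \<epsilon>1[OF t] pos by (simp add: mult_nonpos_nonneg mult_nonneg_nonpos)
    moreover have "0 \<le> \<delta> * \<beta> t * \<epsilon> t / 2 * inner (w t - ws) (w t - ws)"
      using pos by simp
    moreover have "0 \<le> \<delta> * \<beta> t * (h ws - h (w t) - inner (ws - w t) (gradh (w t))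
          + 1/2 * inner (K (w t) - b) (K (w t) - b))"
      using conv[of "w t"] pos by (intro mult_nonneg_nonneg add_nonneg_nonneg) auto
    ultimately show ?thesis unfolding D_def by linarith
  qed
  \<comment> \<open>\<open>\<Phi>\<close> is an arbitrary primitive of
    \<open>\<beta> t * \<epsilon> t\<close>; its additive constant is absorbed into
    \<open>C\<close>.\<close>
  define C where "C = E t0 - \<delta> / 2 * inner ws ws * \<Phi> t0"
  show thesis
  proof (rule that)
    fix t assume t: "t \<ge> t0"
    have "E t - \<delta> / 2 * inner ws ws * \<Phi> t \<le> C"
      unfolding C_def
      by (rule nonincreasing_if_derivative_nonpos[where E = "\<lambda>t. E t - \<delta> / 2 * inner ws ws * \<Phi> t",
            OF DERIV_diff[OF dE DERIV_cmult[OF d\<Phi>]] D_le t])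
    moreover have "\<delta>\<^sup>2 * \<beta> t * gap (w t) \<le> E t"
    proof -
      have "0 \<le> \<delta>\<^sup>2 * \<beta> t * (\<epsilon> t / 2 * inner (w t) (w t))"
        using \<beta>_nonneg[OF t] \<epsilon>_nonneg[OF t] by simp
      moreover have "0 \<le> (\<delta> * \<gamma> - 1) / 2 * inner (w t - ws) (w t - ws)"
        using \<gamma>\<delta> by simp
      moreover have "0 \<le> \<delta> / 2 * inner (lam t - lams) (lam t - lams)"
        using \<open>\<delta> > 0\<close> by simp
      ultimately show ?thesis
        unfolding E_def distrib_left using inner_ge_zero[of "V t"] by linarith
    qed
    ultimately show "\<delta>\<^sup>2 * \<beta> t * gap (w t) \<le> C + \<delta> / 2 * (norm ws)\<^sup>2 * \<Phi> t"
      by (simp add: power2_norm_eq_inner)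
  qed
qed

section \<open>Saddle points and the decay rates\<close>

text \<open>The Lagrangian is affine in the multiplier. Shifting \<open>lams\<close> by the residual
  raises the value by the squared norm of the residual, which the left saddle inequality does not
  allow unless it is zero.\<close>

lemma saddle_point_feasible:
  assumes "(xs, ys, lams) \<in> saddle_points f g A B b"
  shows "A xs + B ys = b"
proof -
  let ?r = "A xs + B ys - b"
  have "aug_lagrangian f g A B b xs ys (lams + ?r) \<le> aug_lagrangian f g A B b xs ys lams"
    using assms unfolding saddle_points_def by blast
  then have "inner ?r ?r \<le> 0"
    by (simp add: aug_lagrangian_def inner_add_left)
  then have "?r = 0"
    by (metis inner_ge_zero inner_eq_zero_iff order_antisym)
  then show ?thesis by simp
qed

theorem theorem4p5:
  fixes f :: "'x::{real_inner,complete_space} \<Rightarrow> real"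
    and g :: "'y::{real_inner,complete_space} \<Rightarrow> real"
    and gradf :: "'x \<Rightarrow> 'x" and gradg :: "'y \<Rightarrow> 'y"
    and A :: "'x \<Rightarrow> 'z::{real_inner,complete_space}" and B :: "'y \<Rightarrow> 'z" and b :: 'z
    and l1 l2 t0 \<gamma> \<delta> r1 r2 c :: real
    and x :: "real \<Rightarrow> 'x" and y :: "real \<Rightarrow> 'y" and lam :: "real \<Rightarrow> 'z"
    and xs :: 'x and ys :: 'y and lams :: 'z
  assumes "bounded_linear A" and "bounded_linear B"
    and "convex_on UNIV f" and "convex_on UNIV g"
    and "\<And>u. GDERIV f u :> gradf u" and "\<And>v. GDERIV g v :> gradg v"
    and "continuous_on UNIV gradf" and "continuous_on UNIV gradg"
    and "l1 > 0" and "l2 > 0"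
    and "l1-lipschitz_on UNIV gradf" and "l2-lipschitz_on UNIV gradg"
    and "saddle_points f g A B b \<noteq> {}"
    and "t0 > 0" and "\<gamma> > 0" and "\<delta> > 0"
    and "1 < r2" and "r2 \<le> r1 + 1" and "c > 0"
    and "1 / \<delta> \<le> \<gamma>"
    and "\<And>t. t \<ge> t0 \<Longrightarrow> r1 \<le> t / \<delta>"
    and "ds_solution t0 \<gamma> \<delta> (\<lambda>t. t powr r1) (\<lambda>t. c / t powr r2) gradf gradg A B b x y lam"
    and "(xs, ys, lams) \<in> saddle_points f g A B b"
  shows "(r2 < r1 + 1 \<longrightarrow>
      (\<lambda>t. aug_lagrangian f g A B b (x t) (y t) lams - aug_lagrangian f g A B b xs ys lams)
        \<in> O[at_top](\<lambda>t. 1 / t powr (r2 - 1))) \<and>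
    (r2 = r1 + 1 \<longrightarrow>
      (\<lambda>t. aug_lagrangian f g A B b (x t) (y t) lams - aug_lagrangian f g A B b xs ys lams)
        \<in> O[at_top](\<lambda>t. ln t / t powr r1))"
proof -
  note A = \<open>bounded_linear A\<close> and B = \<open>bounded_linear B\<close>
  \<comment> \<open>On the product space the equations for \<open>x\<close> and \<open>y\<close>
    become a single one, with constraint map \<open>K\<close> and objective
    \<open>h\<close>.\<close>
  define K where "K u = A (fst u) + B (snd u)" for u
  define h where "h u = f (fst u) + g (snd u)" for u
  define gap where "gap t = aug_lagrangian f g A B b (x t) (y t) lams
    - aug_lagrangian f g A B b xs ys lams" for t
  note feasible = saddle_point_feasible[OF assms(23)]
  \<comment> \<open>Feasibility reduces the Lagrangian at the saddle point to
    \<open>h (xs, ys)\<close>.\<close>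
  have gap_eq: "aug_lagrangian f g A B b (fst u) (snd u) lams - aug_lagrangian f g A B b xs ys lams
    = h u + inner lams (K u - b) + 1/2 * (norm (K u - b))\<^sup>2 - h (xs, ys)" for u
    using feasible by (simp add: aug_lagrangian_def h_def K_def)
  have gap_nonneg: "0 \<le> h u + inner lams (K u - b) + 1/2 * (norm (K u - b))\<^sup>2 - h (xs, ys)" for u
    unfolding gap_eq[symmetric] using assms(23) unfolding saddle_points_def by simp
  have "r1 > 0" using assms by simp
  obtain x1 x2 y1 y2 lam1 where sol: "\<forall>t\<ge>t0.
       (x has_vector_derivative x1 t) (at t within {t0..}) \<and>
       (x1 has_vector_derivative x2 t) (at t within {t0..}) \<and>
       (y has_vector_derivative y1 t) (at t within {t0..}) \<and>
       (y1 has_vector_derivative y2 t) (at t within {t0..}) \<and>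
       (lam has_vector_derivative lam1 t) (at t within {t0..}) \<and>
       x2 t + \<gamma> *\<^sub>R x1 t + t powr r1 *\<^sub>R (gradf (x t) + adjoint A (lam t)
          + adjoint A (A (x t) + B (y t) - b) + (c / t powr r2) *\<^sub>R x t) = 0 \<and>
       y2 t + \<gamma> *\<^sub>R y1 t + t powr r1 *\<^sub>R (gradg (y t) + adjoint B (lam t)
          + adjoint B (A (x t) + B (y t) - b) + (c / t powr r2) *\<^sub>R y t) = 0 \<and>
       lam1 t - t powr r1 *\<^sub>R (A (x t + \<delta> *\<^sub>R x1 t) + B (y t + \<delta> *\<^sub>R y1 t) - b) = 0"
    using assms(22) unfolding ds_solution_def by blast
  \<comment> \<open>The primitive \<open>\<Phi>\<close> stays a parameter so that the power case and
    the logarithmic case share one estimate.\<close>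
  have gap_bound: "\<exists>C. \<forall>t\<ge>t0. \<delta>\<^sup>2 * t powr r1 * gap t \<le> C + \<delta> / 2 * (norm (xs, ys))\<^sup>2 * \<Phi> t"
    if d\<Phi>: "\<And>t. t \<ge> t0 \<Longrightarrow>
      (\<Phi> has_real_derivative t powr r1 * (c / t powr r2)) (at t within {t0..})" for \<Phi>
  proof (rule lyapunov_gap_bound[where h = h and K = K and b = b and lams = lams
        and ws = "(xs, ys)" and K' = "\<lambda>z. (adjoint A z, adjoint B z)"
        and gradh = "\<lambda>u. (gradf (fst u), gradg (snd u))" and \<delta> = \<delta> and \<gamma> = \<gamma> and ?t0.0 = t0
        and w = "\<lambda>t. (x t, y t)" and ?w1.0 = "\<lambda>t. (x1 t, y1 t)" and ?w2.0 = "\<lambda>t. (x2 t, y2 t)"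
        and lam = lam and \<beta> = "\<lambda>t. t powr r1" and \<epsilon> = "\<lambda>t. c / t powr r2"
        and ?\<beta>1.0 = "\<lambda>t. r1 * t powr (r1 - 1)" and ?\<epsilon>1.0 = "\<lambda>t. - (c * r2) * t powr (- r2 - 1)"])
    show "bounded_linear K"
      unfolding K_def
      by (intro bounded_linear_add bounded_linear_compose[OF A bounded_linear_fst]
          bounded_linear_compose[OF B bounded_linear_snd])
    show "inner (K u) z = inner u (adjoint A z, adjoint B z)" for u z
      by (simp add: K_def inner_add_left inner_adjoint[OF A] inner_adjoint[OF B] inner_prod_def)
    show "GDERIV h u :> (gradf (fst u), gradg (snd u))" for u
      using has_derivative_add[OF
          has_derivative_compose[OF has_derivative_fst[OF has_derivative_ident]
            assms(5)[of "fst u", unfolded gderiv_def], of UNIV]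
          has_derivative_compose[OF has_derivative_snd[OF has_derivative_ident]
            assms(6)[of "snd u", unfolded gderiv_def], of UNIV]]
      by (simp add: gderiv_def h_def[abs_def] inner_prod_def)
    show "h u + inner ((xs, ys) - u) (gradf (fst u), gradg (snd u)) \<le> h (xs, ys)" for u
      using convex_on_GDERIV_le[OF assms(3) assms(5), of "fst u" xs]
        convex_on_GDERIV_le[OF assms(4) assms(6), of "snd u" ys]
      by (simp add: h_def inner_prod_def)
    show "K (xs, ys) = b" using feasible by (simp add: K_def)
    show "0 \<le> h u + inner lams (K u - b) + 1/2 * (norm (K u - b))\<^sup>2 - h (xs, ys)" for u
      by (rule gap_nonneg)
    show "\<delta> > 0" "1 / \<delta> \<le> \<gamma>" by fact+
    fix t assume t: "t \<ge> t0"
    then have "t > 0" using \<open>t0 > 0\<close> by simp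
    show "((\<lambda>t. (x t, y t)) has_vector_derivative (x1 t, y1 t)) (at t within {t0..})"
      "((\<lambda>t. (x1 t, y1 t)) has_vector_derivative (x2 t, y2 t)) (at t within {t0..})"
      using sol t by (auto intro!: has_vector_derivative_Pair)
    show "(lam has_vector_derivative t powr r1 *\<^sub>R (K ((x t, y t) + \<delta> *\<^sub>R (x1 t, y1 t)) - b))
        (at t within {t0..})"
    proof -
      have "lam1 t = t powr r1 *\<^sub>R (K ((x t, y t) + \<delta> *\<^sub>R (x1 t, y1 t)) - b)"
        using sol t by (simp add: K_def)
      moreover have "(lam has_vector_derivative lam1 t) (at t within {t0..})"
        using sol t by blast
      ultimately show ?thesis by simp
    qed
    show "(x2 t, y2 t) + \<gamma> *\<^sub>R (x1 t, y1 t) + t powr r1 *\<^sub>R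
        ((gradf (fst (x t, y t)), gradg (snd (x t, y t))) + (adjoint A (lam t), adjoint B (lam t))
          + (adjoint A (K (x t, y t) - b), adjoint B (K (x t, y t) - b))
          + (c / t powr r2) *\<^sub>R (x t, y t)) = 0"
      using sol t by (simp add: K_def zero_prod_def)
    show "((\<lambda>t. t powr r1) has_real_derivative r1 * t powr (r1 - 1)) (at t within {t0..})"
      using has_real_derivative_powr[OF \<open>t > 0\<close>, of r1] by (rule DERIV_subset) simp
    show "((\<lambda>t. c / t powr r2) has_real_derivative - (c * r2) * t powr (- r2 - 1)) (at t within {t0..})"
      using DERIV_subset[OF DERIV_cmult[OF has_real_derivative_powr[OF \<open>t > 0\<close>, of "- r2"], of c]]
      by (simp add: powr_minus_divide mult.assoc)
    show "(\<Phi> has_real_derivative t powr r1 * (c / t powr r2)) (at t within {t0..})"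
      by (rule d\<Phi>[OF t])
    show "0 \<le> t powr r1" "0 \<le> c / t powr r2" using \<open>c > 0\<close> by simp_all
    \<comment> \<open>The growth condition on \<open>\<beta>\<close> is the hypothesis
      \<open>r1 \<le> t / \<delta>\<close> multiplied by
      \<open>\<delta> * t powr (r1 - 1)\<close>.\<close>
    show "\<delta> * (r1 * t powr (r1 - 1)) \<le> t powr r1"
    proof -
      have "\<delta> * r1 \<le> t" using assms(21)[OF t] \<open>\<delta> > 0\<close> by (simp add: field_simps)
      then have "\<delta> * r1 * t powr (r1 - 1) \<le> t * t powr (r1 - 1)"
        by (intro mult_right_mono) auto
      then show ?thesis using \<open>t > 0\<close> by (simp add: powr_diff mult.assoc)
    qed
    show "- (c * r2) * t powr (- r2 - 1) \<le> 0"
      using \<open>c > 0\<close> \<open>1 < r2\<close> by simp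
  next
    fix C assume C: "\<And>t. t \<ge> t0 \<Longrightarrow> \<delta>\<^sup>2 * t powr r1 *
        (h (x t, y t) + inner lams (K (x t, y t) - b) + 1/2 * (norm (K (x t, y t) - b))\<^sup>2 - h (xs, ys))
        \<le> C + \<delta> / 2 * (norm (xs, ys))\<^sup>2 * \<Phi> t"
    show ?thesis
      using C unfolding gap_eq[symmetric] by (auto simp: gap_def)
  qed
  \<comment> \<open>The factor \<open>k\<close> lets \<open>\<Psi>\<close> be the bare power or
    logarithm, without normalizing constants. Being eventually at least 1, \<open>\<Psi>\<close>
    also dominates the constant \<open>C\<close> of the energy bound.\<close>
  have bigo: "gap \<in> O[at_top](\<lambda>t. \<Psi> t / t powr r1)"
    if d\<Psi>: "\<And>t. t > 0 \<Longrightarrow> (\<Psi> has_real_derivative k * (t powr r1 * (1 / t powr r2))) (at t)"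
      and "k > 0" and ge1: "eventually (\<lambda>t. 1 \<le> \<Psi> t) at_top" for \<Psi> k
  proof -
    have "((\<lambda>t. c / k * \<Psi> t) has_real_derivative t powr r1 * (c / t powr r2)) (at t within {t0..})"
      if "t \<ge> t0" for t
      using DERIV_subset[OF DERIV_cmult[OF d\<Psi>, of t "c / k"]] that \<open>t0 > 0\<close> \<open>k > 0\<close>
      by (simp add: mult.commute)
    from gap_bound[OF this] obtain C where
      C: "\<And>t. t \<ge> t0 \<Longrightarrow> \<delta>\<^sup>2 * t powr r1 * gap t \<le> C + \<delta> / 2 * (norm (xs, ys))\<^sup>2 * (c / k * \<Psi> t)"
      by blast
    \<comment> \<open>\<open>M\<close> collects the coefficients of \<open>\<Psi> t\<close> after
      \<open>C\<close> is replaced by \<open>\<bar>C\<bar> * \<Psi> t\<close>, divided by the weight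
      \<open>\<delta>\<^sup>2\<close> of the gap.\<close>
    define M where "M = (\<bar>C\<bar> + \<delta> / 2 * (norm (xs, ys))\<^sup>2 * (c / k)) / \<delta>\<^sup>2"
    show ?thesis
    proof (rule bigoI[of _ M], use ge1 eventually_ge_at_top[of t0] in eventually_elim)
      fix t assume "1 \<le> \<Psi> t" "t0 \<le> t"
      have "C \<le> \<bar>C\<bar> * \<Psi> t"
        using mult_left_mono[OF \<open>1 \<le> \<Psi> t\<close>, of "\<bar>C\<bar>"] by simp
      moreover have "\<delta>\<^sup>2 * M = \<bar>C\<bar> + \<delta> / 2 * (norm (xs, ys))\<^sup>2 * (c / k)"
        using \<open>\<delta> > 0\<close> by (simp add: M_def)
      then have "\<delta>\<^sup>2 * (M * \<Psi> t) = \<bar>C\<bar> * \<Psi> t + \<delta> / 2 * (norm (xs, ys))\<^sup>2 * (c / k * \<Psi> t)"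
        by (simp only: mult.assoc[symmetric] distrib_right)
      ultimately have "\<delta>\<^sup>2 * (t powr r1 * gap t) \<le> \<delta>\<^sup>2 * (M * \<Psi> t)"
        using C[OF \<open>t0 \<le> t\<close>] by (simp add: mult.assoc)
      then have "t powr r1 * gap t \<le> M * \<Psi> t" using \<open>\<delta> > 0\<close> by simp
      moreover have "gap t \<ge> 0"
        using gap_nonneg[of "(x t, y t)"] unfolding gap_eq[symmetric] by (simp add: gap_def)
      ultimately show "norm (gap t) \<le> M * norm (\<Psi> t / t powr r1)"
        using \<open>1 \<le> \<Psi> t\<close> \<open>t0 \<le> t\<close> \<open>t0 > 0\<close> by (simp add: field_simps)
    qed
  qed
  show ?thesis
  proof (intro conjI impI)
    assume "r2 < r1 + 1"
    \<comment> \<open>\<open>t powr p\<close> has derivative \<open>p * t powr (r1 - r2)\<close>, so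
      \<open>k = p\<close>; positivity of \<open>p\<close> makes the power at least 1 from
      \<open>t = 1\<close> on.\<close>
    define p where "p = r1 - r2 + 1"
    have "p > 0" using \<open>r2 < r1 + 1\<close> by (simp add: p_def)
    have "gap \<in> O[at_top](\<lambda>t. t powr p / t powr r1)"
    proof (rule bigo[of _ p])
      fix t :: real assume "t > 0"
      have "p - 1 = r1 - r2" by (simp add: p_def)
      then have "t powr (p - 1) = t powr r1 * (1 / t powr r2)"
        by (simp add: powr_diff)
      then show "((\<lambda>t. t powr p) has_real_derivative p * (t powr r1 * (1 / t powr r2))) (at t)"
        using has_real_derivative_powr[OF \<open>t > 0\<close>, of p] by simp
    next
      show "eventually (\<lambda>t. 1 \<le> t powr p) at_top"
        using eventually_ge_at_top[of "1::real"]
        by eventually_elim (use \<open>p > 0\<close> in \<open>simp add: ge_one_powr_ge_zero\<close>)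
    qed fact
    moreover have "t powr p / t powr r1 = 1 / t powr (r2 - 1)" for t
    proof -
      have "t powr p / t powr r1 = t powr (p - r1)" by (simp add: powr_diff)
      also have "p - r1 = - (r2 - 1)" by (simp add: p_def)
      finally show ?thesis by (simp only: powr_minus_divide)
    qed
    ultimately show "(\<lambda>t. aug_lagrangian f g A B b (x t) (y t) lams
        - aug_lagrangian f g A B b xs ys lams) \<in> O[at_top](\<lambda>t. 1 / t powr (r2 - 1))"
      by (simp add: gap_def[abs_def])
  next
    assume r2: "r2 = r1 + 1"
    \<comment> \<open>Here the integrand exponent \<open>r1 - r2\<close> is -1, so the primitive is
      \<open>ln\<close>, which is at least 1 from \<open>exp 1\<close> on.\<close>
    have "gap \<in> O[at_top](\<lambda>t. ln t / t powr r1)"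
    proof (rule bigo[of _ 1])
      fix t :: real assume "t > 0"
      then show "(ln has_real_derivative 1 * (t powr r1 * (1 / t powr r2))) (at t)"
        using DERIV_ln_divide[of t] by (simp add: r2 powr_add)
    next
      show "eventually (\<lambda>t::real. 1 \<le> ln t) at_top"
        using eventually_ge_at_top[of "exp 1 :: real"]
        by eventually_elim (simp add: ln_ge_iff less_le_trans[OF exp_gt_zero])
    qed simp
    then show "(\<lambda>t. aug_lagrangian f g A B b (x t) (y t) lams
        - aug_lagrangian f g A B b xs ys lams) \<in> O[at_top](\<lambda>t. ln t / t powr r1)"
      by (simp add: gap_def[abs_def])
  qed
qed

end
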